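(* Let $\mathscr{E}=\{\eta_i,\rho_i\}_{i=1}^n$ be a multipartite quantum state ensemble on $\mathscr{H}=\bigotimes_{k=1}^m\mathbb{C}^{d_k}$. Then for each $j=1,\ldots,n$, $$\mathcal{S}_j(\mathscr{E})=\mathcal{Q}_j(\mathscr{E}).$$
   Context: Let $\mathscr{H}=\bigotimes_{k=1}^m\mathbb{C}^{d_k}$ with $m\geqslant 2$ and positive integers $d_1,\ldots,d_m$. $\mathbb{H}$ is the set of Hermitian operators on $\mathscr{H}$, and $\mathbb{H}_+\subseteq\mathbb{H}$ is the set of positive-semidefinite ones. A state is $\rho\in\mathbb{H}_+$ with $\operatorname{Tr}\rho=1$. An ensemble $\{\eta_i,\rho_i\}_{i=1}^n$ consists of states $\rho_i$ with nonzero probabilities $\eta_i$ (so $\eta_i>0$, $\sum_i\eta_i=1$), and $\rho_0=\sum_{i=1}^n\eta_i\rho_i$. An operator $E\in\mathbb{H}_+$ is separable if $E=\sum_l p_l\bigotimes_{k=1}^m\sigma_l^{(k)}$ with $p_l\geqslant 0$ and $\sigma_l^{(k)}$ states on $\mathbb{C}^{d_k}$; $\mathbb{SEP}$ is the set of all separable operators. An operator $E\in\mathbb{H}$ is block positive if $\operatorname{Tr}(EF)\geqslant0$ for all $F\in\mathbb{SEP}$; $\mathbb{SEP}^*$ is the set of all block-positive operators. A separable measurement is a family $\mathscr{M}=\{M_i\}_{i=0}^n\subseteq\mathbb{SEP}$ with $\sum_iM_i=\mathbb{1}$. When $\operatorname{Tr}(\rho_0M_j)\neq0$, the confidence to identify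 $\rho_j$ is $\Pr(\rho_j|M_j)=\dfrac{\eta_j\operatorname{Tr}(\rho_jM_j)}{\operatorname{Tr}(\rho_0M_j)}$. $\mathcal{S}_j(\mathscr{E})$ is the maximum of $\Pr(\rho_j|M_j)$ over all separable measurements with $\operatorname{Tr}(\rho_0M_j)\neq 0$. $\mathcal{Q}_j(\mathscr{E})=\min\{q\in\mathbb{R}\mid q\rho_0-\eta_j\rho_j\in\mathbb{SEP}^*\}$.
   Formalization: S_j is taken as the supremum of the confidences instead of the maximum, since the maximum need not be attained when ρ_0 is singular; the two agree whenever the maximum exists. *)

theory Defs
  imports "Jordan_Normal_Form.Schur_Decomposition"
begin

text \<open>
  The space \<open>\<Otimes>\<^sub>k \<complex>^(d\<^sub>k)\<close> is given by the list \<open>ds = [d\<^sub>1, \<dots>, d\<^sub>m]\<close> of its local dimensions.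
  Its operators are the complex matrices of size \<open>prod_list ds\<close>, with respect to the product basis
  in lexicographic order.
\<close>

definition mtrace :: "complex mat \<Rightarrow> complex" where
  "mtrace A = (\<Sum>i<dim_row A. A $$ (i, i))"

text \<open>
  Matrices of unspecified dimension form no additive monoid, so the size \<open>n\<close> is an explicit
  argument; the sum is taken entrywise.
\<close>

definition mat_sum :: "nat \<Rightarrow> ('i \<Rightarrow> complex mat) \<Rightarrow> 'i set \<Rightarrow> complex mat" where
  "mat_sum n A I = mat n n (\<lambda>ij. \<Sum>i\<in>I. A i $$ ij)"

definition kronecker :: "complex mat \<Rightarrow> complex mat \<Rightarrow> complex mat" where
  "kronecker A B = mat (dim_row A * dim_row B) (dim_col A * dim_col B)
     (\<lambda>(i, j). A $$ (i div dim_row B, j div dim_col B) * B $$ (i mod dim_row B, j mod dim_col B))"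

definition tensor :: "complex mat list \<Rightarrow> complex mat" where
  "tensor As = foldr kronecker As (1\<^sub>m 1)"

definition hermitian_ops :: "nat \<Rightarrow> complex mat set" where
  "hermitian_ops n = {A \<in> carrier_mat n n. mat_adjoint A = A}"

text \<open>
  For Hermitian \<open>A\<close> the quadratic form below is real; likewise the trace of a product of two
  Hermitian matrices is real. Taking \<open>Re\<close>, here and later, only changes the type.
\<close>

definition psd_ops :: "nat \<Rightarrow> complex mat set" where
  "psd_ops n = {A \<in> hermitian_ops n. \<forall>v\<in>carrier_vec n. 0 \<le> Re ((A *\<^sub>v v) \<bullet>c v)}"

definition states :: "nat \<Rightarrow> complex mat set" where
  "states n = {A \<in> psd_ops n. mtrace A = 1}"

definition separable_ops :: "nat list \<Rightarrow> complex mat set" where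
  "separable_ops ds = {E \<in> psd_ops (prod_list ds).
     \<exists>(L :: nat) (p :: nat \<Rightarrow> real) (\<sigma> :: nat \<Rightarrow> nat \<Rightarrow> complex mat).
       (\<forall>l<L. 0 \<le> p l) \<and>
       (\<forall>l<L. \<forall>k<length ds. \<sigma> l k \<in> states (ds ! k)) \<and>
       E = mat_sum (prod_list ds)
             (\<lambda>l. complex_of_real (p l) \<cdot>\<^sub>m tensor (map (\<sigma> l) [0..<length ds])) {..<L}}"

definition block_positive_ops :: "nat list \<Rightarrow> complex mat set" where
  "block_positive_ops ds = {E \<in> hermitian_ops (prod_list ds).
     \<forall>F\<in>separable_ops ds. 0 \<le> Re (mtrace (E * F))}"

definition ensemble :: "nat list \<Rightarrow> nat \<Rightarrow> (nat \<Rightarrow> real) \<Rightarrow> (nat \<Rightarrow> complex mat) \<Rightarrow> bool" where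
  "ensemble ds n \<eta> \<rho> \<longleftrightarrow>
     (\<forall>i\<in>{1..n}. \<rho> i \<in> states (prod_list ds)) \<and> (\<forall>i\<in>{1..n}. 0 < \<eta> i) \<and> (\<Sum>i=1..n. \<eta> i) = 1"

definition average_state ::
    "nat list \<Rightarrow> nat \<Rightarrow> (nat \<Rightarrow> real) \<Rightarrow> (nat \<Rightarrow> complex mat) \<Rightarrow> complex mat" where
  "average_state ds n \<eta> \<rho> = mat_sum (prod_list ds) (\<lambda>i. complex_of_real (\<eta> i) \<cdot>\<^sub>m \<rho> i) {1..n}"

definition separable_measurement :: "nat list \<Rightarrow> nat \<Rightarrow> (nat \<Rightarrow> complex mat) \<Rightarrow> bool" where
  "separable_measurement ds n M \<longleftrightarrow>
     (\<forall>i\<in>{0..n}. M i \<in> separable_ops ds) \<and> mat_sum (prod_list ds) M {0..n} = 1\<^sub>m (prod_list ds)"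

definition confidence ::
    "nat list \<Rightarrow> nat \<Rightarrow> (nat \<Rightarrow> real) \<Rightarrow> (nat \<Rightarrow> complex mat) \<Rightarrow> nat \<Rightarrow> (nat \<Rightarrow> complex mat) \<Rightarrow> real" where
  "confidence ds n \<eta> \<rho> j M =
     \<eta> j * Re (mtrace (\<rho> j * M j)) / Re (mtrace (average_state ds n \<eta> \<rho> * M j))"

text \<open>
  The best confidence is a supremum because a maximum need not exist when the average state
  \<open>\<rho>\<^sub>0\<close> is singular. On two qubits let \<open>P\<close> project onto the span of \<open>|01>, |10>, |11>\<close>, let
  \<open>\<psi> = (|01> + |10>) / sqrt 2\<close>, \<open>\<eta>\<^sub>1 = 1/3\<close>, \<open>\<rho>\<^sub>1 = |\<psi>><\<psi>|\<close>, \<open>\<eta>\<^sub>2 = 2/3\<close> and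
  \<open>\<rho>\<^sub>2 = (P - |\<psi>><\<psi>|) / 2\<close>. Product vectors \<open>(1, t) \<otimes> (1, t)\<close> with \<open>t\<close> tending to \<open>0\<close> give
  confidences in \<open>\<rho>\<^sub>1\<close> tending to \<open>1\<close>. The value \<open>1\<close> would need a product vector, not a
  multiple of \<open>|00>\<close>, in the span of \<open>|00>\<close> and \<open>\<psi>\<close>, and there is none.
  The set is always nonempty (take \<open>M j = 1\<close>, all other elements \<open>0\<close>) and lies in \<open>[0, 1]\<close>, so
  its supremum is the maximum whenever the latter exists.
\<close>

definition sep_max_confidence ::
    "nat list \<Rightarrow> nat \<Rightarrow> (nat \<Rightarrow> real) \<Rightarrow> (nat \<Rightarrow> complex mat) \<Rightarrow> nat \<Rightarrow> real" where
  "sep_max_confidence ds n \<eta> \<rho> j = Sup {confidence ds n \<eta> \<rho> j M | M.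
     separable_measurement ds n M \<and> mtrace (average_state ds n \<eta> \<rho> * M j) \<noteq> 0}"

definition block_positive_bound ::
    "nat list \<Rightarrow> nat \<Rightarrow> (nat \<Rightarrow> real) \<Rightarrow> (nat \<Rightarrow> complex mat) \<Rightarrow> nat \<Rightarrow> real" where
  "block_positive_bound ds n \<eta> \<rho> j = (LEAST q :: real.
     complex_of_real q \<cdot>\<^sub>m average_state ds n \<eta> \<rho> - complex_of_real (\<eta> j) \<cdot>\<^sub>m \<rho> j
       \<in> block_positive_ops ds)"

end

theory Submission
  imports Defs "HOL-Analysis.L2_Norm"
begin

text \<open>
  A real \<open>q\<close> bounds every confidence iff \<open>q \<rho>\<^sub>0 - \<eta>\<^sub>j \<rho>\<^sub>j\<close> is block positive; the least such \<open>q\<close> is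
  therefore the supremum of the confidences. If the operator is block positive, pair it with \<open>M\<^sub>j\<close>.
  Conversely, block positivity need only be tested on tensor products \<open>T\<close> of states. For these,
  \<open>1 - T\<close> is separable by telescoping, so \<open>M\<^sub>j = T\<close>, \<open>M\<^sub>0 = 1 - T\<close> is a separable measurement whose
  confidence \<open>q\<close> dominates. Where \<open>Tr (\<rho>\<^sub>0 T) = 0\<close>, also \<open>\<eta>\<^sub>j Tr (\<rho>\<^sub>j T) = 0\<close> because
  \<open>\<eta>\<^sub>j \<rho>\<^sub>j \<le> \<rho>\<^sub>0\<close>.
\<close>

section \<open>Positive semidefinite matrices\<close>

text \<open>Kernels and vectors are plain functions of which only the values below \<open>n\<close>
  matter, so an induction on the dimension needs no submatrices.\<close>

definition quad_form :: "nat \<Rightarrow> (nat \<Rightarrow> nat \<Rightarrow> complex) \<Rightarrow> (nat \<Rightarrow> complex) \<Rightarrow> complex" where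
  "quad_form n f v = (\<Sum>i<n. \<Sum>j<n. cnj (v i) * f i j * v j)"

lemma quad_form_cong:
  assumes "\<And>i j. i < n \<Longrightarrow> j < n \<Longrightarrow> f i j = g i j" and "\<And>i. i < n \<Longrightarrow> v i = w i"
  shows "quad_form n f v = quad_form n g w"
  using assms by (simp add: quad_form_def)

text \<open>Splits off the last coordinate. By Hermitian symmetry the last column is the conjugate
  of the last row, so one functional \<open>s\<close> describes both mixed terms.\<close>

lemma quad_form_Suc:
  assumes herm: "\<And>i j. i < Suc n \<Longrightarrow> j < Suc n \<Longrightarrow> f i j = cnj (f j i)"
  defines "s \<equiv> \<lambda>v. \<Sum>j<n. f n j * v j"
  shows "quad_form (Suc n) f v =
    quad_form n f v + cnj (s v) * v n + cnj (v n) * s v + cnj (v n) * f n n * v n"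
proof -
  have "(\<Sum>i<n. cnj (v i) * f i n * v n) = cnj (s v) * v n"
    unfolding s_def cnj_sum sum_distrib_right
    by (rule sum.cong) (simp_all add: herm[of _ n] mult_ac)
  moreover have "(\<Sum>j<n. cnj (v n) * f n j * v j) = cnj (v n) * s v"
    unfolding s_def sum_distrib_left by (rule sum.cong) (auto simp: mult_ac)
  ultimately show ?thesis
    by (simp add: quad_form_def sum.distrib)
qed

text \<open>The double sum factors into the inner product of \<open>c\<close> with \<open>v\<close>
  and its conjugate.\<close>

lemma quad_form_rank_one:
  "quad_form n (\<lambda>i j. c i * cnj (c j)) v = of_real ((cmod (\<Sum>i<n. cnj (c i) * v i))\<^sup>2)"
proof -
  have "quad_form n (\<lambda>i j. c i * cnj (c j)) v
      = cnj (\<Sum>i<n. cnj (c i) * v i) * (\<Sum>j<n. cnj (c j) * v j)"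
    unfolding quad_form_def cnj_sum sum_product by (intro sum.cong refl) simp
  then show ?thesis
    unfolding complex_norm_square by (simp only: mult.commute)
qed

lemma quad_form_sum:
  "quad_form n (\<lambda>i j. \<Sum>k\<in>K. f k i j) v = (\<Sum>k\<in>K. quad_form n (f k) v)"
proof -
  have "quad_form n (\<lambda>i j. \<Sum>k\<in>K. f k i j) v
      = (\<Sum>i<n. \<Sum>j<n. \<Sum>k\<in>K. cnj (v i) * f k i j * v j)"
    by (simp add: quad_form_def sum_distrib_left sum_distrib_right)
  also have "\<dots> = (\<Sum>i<n. \<Sum>k\<in>K. \<Sum>j<n. cnj (v i) * f k i j * v j)"
    by (intro sum.cong refl sum.swap)
  also have "\<dots> = (\<Sum>k\<in>K. quad_form n (f k) v)"
    unfolding quad_form_def by (rule sum.swap)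
  finally show ?thesis .
qed

section \<open>Positive semidefinite kernels as sums of rank-one kernels\<close>

definition psd_kernel :: "nat \<Rightarrow> (nat \<Rightarrow> nat \<Rightarrow> complex) \<Rightarrow> bool" where
  "psd_kernel n f \<longleftrightarrow>
     (\<forall>i<n. \<forall>j<n. f i j = cnj (f j i)) \<and> (\<forall>v. 0 \<le> Re (quad_form n f v))"

text \<open>A sum of squared moduli is nonnegative. The index set \<open>K\<close> is left free so
  that Kronecker products can use a product of index sets.\<close>

lemma psd_kernel_sum_rank_one:
  assumes "\<And>i j. i < n \<Longrightarrow> j < n \<Longrightarrow> f i j = (\<Sum>k\<in>K. c k i * cnj (c k j))"
  shows "psd_kernel n f"
  unfolding psd_kernel_def
proof (intro conjI allI impI)
  fix i j assume "i < n" "j < n"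
  then show "f i j = cnj (f j i)"
    by (simp add: assms mult.commute)
next
  fix v
  have "quad_form n f v = (\<Sum>k\<in>K. quad_form n (\<lambda>i j. c k i * cnj (c k j)) v)"
    unfolding quad_form_sum[symmetric] by (rule quad_form_cong) (auto simp: assms)
  then show "0 \<le> Re (quad_form n f v)"
    by (simp add: quad_form_rank_one sum_nonneg)
qed

text \<open>Without a diagonal term at \<open>n\<close>, the form is affine in the last coordinate
  of a test vector. A nonzero entry \<open>f n i\<close> would give it a slope, and the form would
  take negative values.\<close>

lemma psd_kernel_zero_pivot:
  assumes psd: "psd_kernel (Suc n) f" and zero: "f n n = 0" and i: "i < n"
  shows "f n i = 0"
proof (rule ccontr)
  assume nz: "f n i \<noteq> 0"
  have herm: "f i j = cnj (f j i)" if "i < Suc n" "j < Suc n" for i j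
    using psd that unfolding psd_kernel_def by blast
  \<comment> \<open>With last coordinate \<open>- t * f n i\<close> the form has real part
    \<open>Re (f i i) - 2 * t * (cmod (f n i))^2\<close>; this \<open>t\<close> makes it
    \<open>-1\<close>.\<close>
  define t where "t = (Re (f i i) + 1) / (2 * (cmod (f n i))\<^sup>2)"
  define v where "v = (\<lambda>k. if k = n then - of_real t * f n i else if k = i then 1 else 0)"
  have vn: "v n = - of_real t * f n i"
    by (simp add: v_def)
  have v1: "v k = (if k = i then 1 else 0)" if "k < n" for k
    using that by (simp add: v_def)
  have "quad_form n f v = quad_form n f (\<lambda>k. if k = i then 1 else 0)"
    by (rule quad_form_cong) (auto simp: v1)
  also have "\<dots> = (\<Sum>k<n. if k = i then f i i else 0)"
    unfolding quad_form_def using i by (intro sum.cong refl) (simp add: if_distrib cong: if_cong)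
  also have "\<dots> = f i i"
    using i by simp
  finally have q: "quad_form n f v = f i i" .
  have s: "(\<Sum>j<n. f n j * v j) = f n i"
    using i by (simp add: v1 if_distrib cong: if_cong)
  have "quad_form (Suc n) f v = f i i + cnj (f n i) * v n + cnj (v n) * f n i + cnj (v n) * f n n * v n"
    using quad_form_Suc[of n f v, OF herm] by (simp add: q s)
  also have "\<dots> = f i i - 2 * of_real t * (f n i * cnj (f n i))"
    by (simp add: vn zero algebra_simps)
  also have "\<dots> = f i i - of_real (2 * t * (cmod (f n i))\<^sup>2)"
    by (simp add: mult.assoc flip: complex_norm_square)
  finally have "Re (quad_form (Suc n) f v) = Re (f i i) - 2 * t * (cmod (f n i))\<^sup>2"
    by simp
  also have "\<dots> = -1"
    using nz by (simp add: t_def field_simps)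
  finally have "Re (quad_form (Suc n) f v) < 0"
    by simp
  then show False
    using psd unfolding psd_kernel_def by (meson not_le)
qed

text \<open>Cholesky elimination of the last index: the Schur complement of the pivot
  \<open>f n n\<close> is again positive semidefinite and is factored by induction; the scaled last
  column supplies the remaining rank-one term.\<close>

lemma psd_kernel_cholesky:
  assumes "psd_kernel n f"
  shows "\<exists>c. \<forall>i<n. \<forall>j<n. f i j = (\<Sum>k<n. c k i * cnj (c k j))"
  using assms
proof (induction n arbitrary: f)
  case 0
  then show ?case by simp
next
  case (Suc n)
  have herm: "f i j = cnj (f j i)" if "i < Suc n" "j < Suc n" for i j
    using Suc.prems that unfolding psd_kernel_def by blast
  have nonneg: "0 \<le> Re (quad_form (Suc n) f v)" for v
    using Suc.prems by (simp add: psd_kernel_def)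
  define a where "a = Re (f n n)"
  have fnn: "f n n = of_real a"
    using herm[of n n] by (simp add: a_def complex_eq_iff)
  have a0: "0 \<le> a"
    using nonneg[of "\<lambda>i. if i = n then 1 else 0"]
    by (simp add: quad_form_def if_distrib a_def cong: if_cong)
  \<comment> \<open>For \<open>a = 0\<close> the left side is \<open>0\<close> by the convention for
    division by zero, and the right side vanishes by the zero-pivot lemma.\<close>
  have pivot: "f i n * of_real a / of_real a = f i n" if "i < n" for i
    using psd_kernel_zero_pivot[OF Suc.prems _ that] herm[of i n] that fnn
    by (cases "a = 0") auto
  \<comment> \<open>If \<open>a = 0\<close>, nothing is subtracted; this is harmless since then row and column \<open>n\<close> vanish.\<close>
  define g where "g = (\<lambda>i j. f i j - f i n * f n j / of_real a)"
  have "psd_kernel n g"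
    unfolding psd_kernel_def
  proof (intro conjI allI impI)
    fix i j assume "i < n" "j < n"
    then show "g i j = cnj (g j i)"
      using herm[of i j] herm[of i n] herm[of n j] herm[of j n] by (simp add: g_def)
  next
    fix v
    define s where "s = (\<Sum>j<n. f n j * v j)"
    \<comment> \<open>Completing the square: for \<open>a > 0\<close> this last coordinate minimizes
      the form of \<open>f\<close> over all extensions of \<open>v\<close>, and the minimum is the
      form of the Schur complement. For \<open>a = 0\<close> the coordinate is
      \<open>0\<close>.\<close>
    define w where "w = v(n := - s / of_real a)"
    have sw: "(\<Sum>j<n. f n j * w j) = s"
      unfolding s_def w_def by (intro sum.cong) auto
    have qw: "quad_form n f w = quad_form n f v"
      by (rule quad_form_cong) (auto simp: w_def)
    have "quad_form (Suc n) f w = quad_form n f v + cnj s * w n + cnj (w n) * s + cnj (w n) * f n n * w n"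
      using quad_form_Suc[of n f w, OF herm] by (simp add: sw qw)
    also have "\<dots> = quad_form n f v - cnj s * s / of_real a"
      by (cases "a = 0") (simp_all add: w_def fnn field_simps)
    also have "\<dots> = quad_form n g v"
    proof -
      have "cnj s = (\<Sum>i<n. cnj (v i) * f i n)"
        unfolding s_def cnj_sum by (rule sum.cong) (use herm[of _ n] in \<open>auto simp: mult_ac\<close>)
      then have "cnj s * s / of_real a = (\<Sum>i<n. cnj (v i) * f i n) * (\<Sum>j<n. f n j * v j) / of_real a"
        by (simp only: s_def)
      also have "\<dots> = (\<Sum>i<n. \<Sum>j<n. cnj (v i) * (f i n * f n j / of_real a) * v j)"
        unfolding sum_product sum_divide_distrib by (intro sum.cong refl) simp
      finally have "cnj s * s / of_real a = (\<Sum>i<n. \<Sum>j<n. cnj (v i) * (f i n * f n j / of_real a) * v j)" .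
      then show ?thesis
        by (simp add: quad_form_def g_def algebra_simps sum_subtractf)
    qed
    finally show "0 \<le> Re (quad_form n g v)"
      using nonneg[of w] by simp
  qed
  then obtain c where c: "\<And>i j. i < n \<Longrightarrow> j < n \<Longrightarrow> g i j = (\<Sum>k<n. c k i * cnj (c k j))"
    using Suc.IH by blast
  \<comment> \<open>The vectors from the induction hypothesis are extended by \<open>0\<close> in
    coordinate \<open>n\<close>; vector \<open>n\<close> is the last column of \<open>f\<close>
    divided by the root of the pivot.\<close>
  define b where "b = (\<lambda>k i. if k < n then if i < n then c k i else 0 else f i n / of_real (sqrt a))"
  have sqrt: "complex_of_real (sqrt a) * of_real (sqrt a) = of_real a"
    using a0 by (simp flip: of_real_mult)
  have last: "b n i * cnj (b n j) = f i n * cnj (f j n) / of_real a" for i j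
    by (simp add: b_def sqrt)
  have "f i j = (\<Sum>k<Suc n. b k i * cnj (b k j))" if ij: "i < Suc n" "j < Suc n" for i j
  proof (cases "i < n \<and> j < n")
    case True
    have "(\<Sum>k<n. b k i * cnj (b k j)) = g i j"
      using True by (simp add: c b_def)
    then show ?thesis
      using True herm[of n j] by (simp add: last g_def)
  next
    case False
    then have "(\<Sum>k<n. b k i * cnj (b k j)) = 0"
      by (auto simp: b_def)
    \<comment> \<open>At least one index is \<open>n\<close>, so only vector \<open>n\<close>
      contributes. The entry is then \<open>pivot\<close> or, in the last row, its
      conjugate.\<close>
    moreover have "f i n * cnj (f j n) / of_real a = f i j"
    proof (cases "j = n")
      case True
      then show ?thesis
        using pivot[of i] ij by (cases "i = n") (auto simp: fnn)
    next
      case j: False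
      then have "i = n" "j < n" using False ij by auto
      then show ?thesis
        using arg_cong[OF pivot[of j], of cnj] herm[of n j]
        by (cases "a = 0") (auto simp: fnn mult.commute)
    qed
    ultimately show ?thesis
      by (simp add: last)
  qed
  then show ?case by blast
qed

section \<open>Transfer from kernels to matrices\<close>

lemma hermitian_ops_iff:
  "A \<in> hermitian_ops n \<longleftrightarrow>
     A \<in> carrier_mat n n \<and> (\<forall>i<n. \<forall>j<n. A $$ (i, j) = cnj (A $$ (j, i)))"
proof -
  have "mat_adjoint A = A \<longleftrightarrow> (\<forall>i<n. \<forall>j<n. A $$ (i, j) = cnj (A $$ (j, i)))"
    if A: "A \<in> carrier_mat n n"
  proof -
    have "mat_adjoint A = mat n n (\<lambda>(i, j). cnj (A $$ (j, i)))"
      using A by (auto simp: mat_adjoint_def mat_of_rows_def)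
    then have "mat_adjoint A = A \<longleftrightarrow> (\<forall>i<n. \<forall>j<n. cnj (A $$ (j, i)) = A $$ (i, j))"
      using A by (simp add: mat_eq_iff)
    then show ?thesis
      by metis
  qed
  then show ?thesis
    by (auto simp: hermitian_ops_def)
qed

text \<open>Both sides test the same quadratic form: a function on all naturals can be cut down to a
  vector of dimension \<open>n\<close> without changing the value.\<close>

lemma psd_ops_iff:
  "A \<in> psd_ops n \<longleftrightarrow> A \<in> carrier_mat n n \<and> psd_kernel n (\<lambda>i j. A $$ (i, j))"
proof -
  have form: "(A *\<^sub>v v) \<bullet>c v = quad_form n (\<lambda>i j. A $$ (i, j)) (($) v)"
    if "A \<in> carrier_mat n n" "v \<in> carrier_vec n" for v
  proof -
    have "(A *\<^sub>v v) \<bullet>c v = (\<Sum>i<n. (\<Sum>j<n. A $$ (i, j) * v $ j) * cnj (v $ i))"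
      using that by (simp add: scalar_prod_def lessThan_atLeast0)
    also have "\<dots> = quad_form n (\<lambda>i j. A $$ (i, j)) (($) v)"
      unfolding quad_form_def by (simp add: sum_distrib_right sum_distrib_left mult_ac)
    finally show ?thesis .
  qed
  have "(\<forall>v\<in>carrier_vec n. 0 \<le> Re ((A *\<^sub>v v) \<bullet>c v)) \<longleftrightarrow>
      (\<forall>v. 0 \<le> Re (quad_form n (\<lambda>i j. A $$ (i, j)) v))" if A: "A \<in> carrier_mat n n"
  proof (intro iffI allI ballI)
    fix v :: "nat \<Rightarrow> complex"
    assume "\<forall>v\<in>carrier_vec n. 0 \<le> Re ((A *\<^sub>v v) \<bullet>c v)"
    then have "0 \<le> Re (quad_form n (\<lambda>i j. A $$ (i, j)) (($) (vec n v)))"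
      using form[OF A, of "vec n v"] vec_carrier[of n v] by metis
    also have "quad_form n (\<lambda>i j. A $$ (i, j)) (($) (vec n v)) = quad_form n (\<lambda>i j. A $$ (i, j)) v"
      by (rule quad_form_cong) auto
    finally show "0 \<le> Re (quad_form n (\<lambda>i j. A $$ (i, j)) v)" .
  qed (simp add: form[OF A])
  then show ?thesis
    unfolding psd_ops_def hermitian_ops_iff psd_kernel_def by blast
qed

text \<open>This rule and the next one make rank-one decompositions the introduction and elimination
  rules for \<open>psd_ops\<close>.\<close>

lemma psd_opsI:
  assumes "A \<in> carrier_mat n n"
    and "\<And>i j. i < n \<Longrightarrow> j < n \<Longrightarrow> A $$ (i, j) = (\<Sum>k\<in>K. c k i * cnj (c k j))"
  shows "A \<in> psd_ops n"
  using assms psd_kernel_sum_rank_one[of n "\<lambda>i j. A $$ (i, j)" c K] by (simp add: psd_ops_iff)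

lemma psd_opsE:
  assumes "A \<in> psd_ops n"
  obtains c where "\<And>i j. i < n \<Longrightarrow> j < n \<Longrightarrow> A $$ (i, j) = (\<Sum>k<n. c k i * cnj (c k j))"
  using psd_kernel_cholesky[of n "\<lambda>i j. A $$ (i, j)"] assms unfolding psd_ops_iff by metis

section \<open>Closure properties of the positive semidefinite cone\<close>

lemma psd_ops_carrier: "A \<in> psd_ops n \<Longrightarrow> A \<in> carrier_mat n n"
  by (simp add: psd_ops_iff)

lemma psd_ops_zero: "0\<^sub>m n n \<in> psd_ops n"
  by (rule psd_opsI[where K = "{}"]) auto

lemma psd_ops_one: "1\<^sub>m n \<in> psd_ops n"
proof (rule psd_opsI[where K = "{..<n}" and c = "\<lambda>k i. if k = i then 1 else 0"])
  fix i j assume "i < n" "j < n"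
  then show "1\<^sub>m n $$ (i, j) =
      (\<Sum>k<n. (if k = i then 1 else 0) * cnj (if k = j then 1 else 0 :: complex))"
    by (simp add: if_distrib cong: if_cong)
qed simp

lemma psd_ops_smult:
  assumes "A \<in> psd_ops n" and "0 \<le> t"
  shows "complex_of_real t \<cdot>\<^sub>m A \<in> psd_ops n"
proof -
  obtain c where c: "\<And>i j. i < n \<Longrightarrow> j < n \<Longrightarrow> A $$ (i, j) = (\<Sum>k<n. c k i * cnj (c k j))"
    using psd_opsE[OF assms(1)] by blast
  have t: "complex_of_real (sqrt t) * of_real (sqrt t) = of_real t"
    using assms(2) by (simp flip: of_real_mult)
  show ?thesis
  proof (rule psd_opsI[where K = "{..<n}" and c = "\<lambda>k i. of_real (sqrt t) * c k i"])
    fix i j assume "i < n" "j < n"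
    then have "(complex_of_real t \<cdot>\<^sub>m A) $$ (i, j) = of_real t * (\<Sum>k<n. c k i * cnj (c k j))"
      using psd_ops_carrier[OF assms(1)] by (simp add: c)
    also have "\<dots> = (\<Sum>k<n. of_real (sqrt t) * c k i * cnj (of_real (sqrt t) * c k j))"
      unfolding sum_distrib_left t[symmetric] by (simp add: mult_ac)
    finally show "(complex_of_real t \<cdot>\<^sub>m A) $$ (i, j) =
      (\<Sum>k<n. of_real (sqrt t) * c k i * cnj (of_real (sqrt t) * c k j))" .
  qed (use psd_ops_carrier[OF assms(1)] in simp)
qed

lemma psd_ops_add:
  assumes "A \<in> psd_ops n" and "B \<in> psd_ops n"
  shows "A + B \<in> psd_ops n"
proof -
  note carr = assms[THEN psd_ops_carrier]
  have eq: "quad_form n (\<lambda>i j. (A + B) $$ (i, j)) v =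
      quad_form n (\<lambda>i j. A $$ (i, j)) v + quad_form n (\<lambda>i j. B $$ (i, j)) v" for v
  proof -
    have "quad_form n (\<lambda>i j. (A + B) $$ (i, j)) v =
        quad_form n (\<lambda>i j. A $$ (i, j) + B $$ (i, j)) v"
      using carr by (intro quad_form_cong) auto
    then show ?thesis
      by (simp add: quad_form_def algebra_simps sum.distrib)
  qed
  have "(A + B) $$ (i, j) = cnj ((A + B) $$ (j, i))" if "i < n" "j < n" for i j
  proof -
    have "A $$ (i, j) = cnj (A $$ (j, i))" "B $$ (i, j) = cnj (B $$ (j, i))"
      using assms that unfolding psd_ops_iff psd_kernel_def by blast+
    then show ?thesis
      using carr that by (metis carrier_matD index_add_mat(1) complex_cnj_add)
  qed
  moreover have "0 \<le> Re (quad_form n (\<lambda>i j. (A + B) $$ (i, j)) v)" for v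
    using assms by (simp add: eq psd_ops_iff psd_kernel_def)
  ultimately show ?thesis
    using carr unfolding psd_ops_iff psd_kernel_def by (simp only: add_carrier_mat) simp
qed

section \<open>Traces and normalization\<close>

lemma mtrace_sum_squares:
  assumes "A \<in> carrier_mat n n"
    and "\<And>i j. i < n \<Longrightarrow> j < n \<Longrightarrow> A $$ (i, j) = (\<Sum>k<n. c k i * cnj (c k j))"
  shows "mtrace A = of_real (\<Sum>k<n. \<Sum>i<n. (cmod (c k i))\<^sup>2)"
proof -
  have "mtrace A = (\<Sum>i<n. \<Sum>k<n. c k i * cnj (c k i))"
    using assms by (simp add: mtrace_def)
  also have "\<dots> = (\<Sum>k<n. \<Sum>i<n. c k i * cnj (c k i))"
    by (rule sum.swap)
  finally show ?thesis
    by (simp only: of_real_sum complex_norm_square)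
qed

text \<open>The trace is the sum of the squared moduli of all entries of the factor vectors, so
  trace zero kills every one of them.\<close>

lemma psd_ops_mtrace_zero:
  assumes "A \<in> psd_ops n" and "mtrace A = 0"
  shows "A = 0\<^sub>m n n"
proof -
  obtain c where c: "\<And>i j. i < n \<Longrightarrow> j < n \<Longrightarrow> A $$ (i, j) = (\<Sum>k<n. c k i * cnj (c k j))"
    using psd_opsE[OF assms(1)] by blast
  note carr = psd_ops_carrier[OF assms(1)]
  have "(\<Sum>k<n. \<Sum>i<n. (cmod (c k i))\<^sup>2) = 0"
    using mtrace_sum_squares[OF carr c] assms(2) by (metis of_real_eq_0_iff)
  then have "c k i = 0" if "k < n" "i < n" for k i
    using that by (simp add: sum_nonneg_eq_0_iff sum_nonneg)
  then show ?thesis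
    using carr by (intro eq_matI) (auto simp: c)
qed

lemma psd_ops_mtrace_nonneg:
  assumes "A \<in> psd_ops n"
  obtains t where "0 \<le> t" and "mtrace A = complex_of_real t"
proof -
  obtain c where c: "\<And>i j. i < n \<Longrightarrow> j < n \<Longrightarrow> A $$ (i, j) = (\<Sum>k<n. c k i * cnj (c k j))"
    using psd_opsE[OF assms(1)] by blast
  show ?thesis
    by (rule that[OF _ mtrace_sum_squares[OF psd_ops_carrier[OF assms] c]]) (simp add: sum_nonneg)
qed

lemma mtrace_smult: "mtrace (a \<cdot>\<^sub>m A) = a * mtrace A" if "A \<in> carrier_mat n n"
  using that by (simp add: mtrace_def sum_distrib_left)

text \<open>Division by the trace gives the state, unless the trace is zero. In that case
  \<open>A\<close> is zero, and any state with weight \<open>0\<close> serves; \<open>0 < n\<close>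
  guarantees that there is one.\<close>

lemma psd_ops_eq_smult_state:
  assumes "A \<in> psd_ops n" and "0 < n"
  obtains t \<sigma> where "0 \<le> t" and "\<sigma> \<in> states n" and "A = complex_of_real t \<cdot>\<^sub>m \<sigma>"
proof -
  obtain t where t: "0 \<le> t" "mtrace A = complex_of_real t"
    using psd_ops_mtrace_nonneg[OF assms(1)] .
  show ?thesis
  proof (cases "t = 0")
    case True
    \<comment> \<open>The maximally mixed state, taken as an arbitrary representative.\<close>
    have "complex_of_real (1 / real n) \<cdot>\<^sub>m 1\<^sub>m n \<in> states n"
      using assms(2) psd_ops_smult[OF psd_ops_one, of "1 / real n" n]
      by (simp add: states_def mtrace_smult[of _ n]) (simp add: mtrace_def)
    moreover have "A = complex_of_real 0 \<cdot>\<^sub>m (complex_of_real (1 / real n) \<cdot>\<^sub>m 1\<^sub>m n)"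
      using psd_ops_mtrace_zero[OF assms(1)] t True by auto
    ultimately show ?thesis
      using that[of 0] by blast
  next
    case False
    note carr = psd_ops_carrier[OF assms(1)]
    have "complex_of_real (1 / t) \<cdot>\<^sub>m A \<in> states n"
      using t False psd_ops_smult[OF assms(1), of "1 / t"]
      by (simp add: states_def mtrace_smult[OF carr])
    moreover have "A = complex_of_real t \<cdot>\<^sub>m (complex_of_real (1 / t) \<cdot>\<^sub>m A)"
      using carr False by (intro eq_matI) auto
    ultimately show ?thesis
      using that t(1) by blast
  qed
qed

text \<open>By Cauchy-Schwarz each rank-one term of the state contributes at most its squared norm
  times the squared norm of \<open>v\<close>; the squared norms of the terms add up to the trace,
  which is \<open>1\<close>.\<close>

lemma one_minus_state_psd:
  assumes "\<sigma> \<in> states n"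
  shows "1\<^sub>m n - \<sigma> \<in> psd_ops n"
proof -
  have psd: "\<sigma> \<in> psd_ops n" and tr: "mtrace \<sigma> = 1"
    using assms by (auto simp: states_def)
  note carr = psd_ops_carrier[OF psd]
  obtain c where c: "\<And>i j. i < n \<Longrightarrow> j < n \<Longrightarrow> \<sigma> $$ (i, j) = (\<Sum>k<n. c k i * cnj (c k j))"
    using psd_opsE[OF psd] by blast
  have norm: "(\<Sum>k<n. \<Sum>i<n. (cmod (c k i))\<^sup>2) = 1"
    using mtrace_sum_squares[OF carr c] tr by (metis of_real_eq_1_iff)
  have "(1\<^sub>m n - \<sigma>) $$ (i, j) = cnj ((1\<^sub>m n - \<sigma>) $$ (j, i))" if "i < n" "j < n" for i j
    using carr that by (simp add: c mult.commute)
  moreover have "0 \<le> Re (quad_form n (\<lambda>i j. (1\<^sub>m n - \<sigma>) $$ (i, j)) v)" for v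
  proof -
    define V where "V = (\<Sum>i<n. (cmod (v i))\<^sup>2)"
    have "quad_form n (\<lambda>i j. 1\<^sub>m n $$ (i, j)) v = (\<Sum>i<n. cnj (v i) * v i)"
      by (simp add: quad_form_def if_distrib if_distribR cong: if_cong)
    also have "\<dots> = of_real V"
      unfolding V_def of_real_sum complex_norm_square by (simp add: mult.commute)
    finally have one: "quad_form n (\<lambda>i j. 1\<^sub>m n $$ (i, j)) v = of_real V" .
    have "quad_form n (\<lambda>i j. \<sigma> $$ (i, j)) v = (\<Sum>k<n. quad_form n (\<lambda>i j. c k i * cnj (c k j)) v)"
      unfolding quad_form_sum[symmetric] by (rule quad_form_cong) (auto simp: c)
    then have sig: "Re (quad_form n (\<lambda>i j. \<sigma> $$ (i, j)) v)
        = (\<Sum>k<n. (cmod (\<Sum>i<n. cnj (c k i) * v i))\<^sup>2)"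
      by (simp add: quad_form_rank_one)
    have "(cmod (\<Sum>i<n. cnj (c k i) * v i))\<^sup>2 \<le> (\<Sum>i<n. (cmod (c k i))\<^sup>2) * V" for k
    proof -
      have "cmod (\<Sum>i<n. cnj (c k i) * v i) \<le> (\<Sum>i<n. \<bar>cmod (c k i)\<bar> * \<bar>cmod (v i)\<bar>)"
        by (rule order_trans[OF norm_sum]) (simp add: norm_mult)
      also have "\<dots> \<le> L2_set (\<lambda>i. cmod (c k i)) {..<n} * L2_set (\<lambda>i. cmod (v i)) {..<n}"
        by (rule L2_set_mult_ineq)
      finally have "(cmod (\<Sum>i<n. cnj (c k i) * v i))\<^sup>2
          \<le> (L2_set (\<lambda>i. cmod (c k i)) {..<n} * L2_set (\<lambda>i. cmod (v i)) {..<n})\<^sup>2"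
        by (rule power_mono) simp
      also have "\<dots> = (\<Sum>i<n. (cmod (c k i))\<^sup>2) * V"
        by (simp add: L2_set_def V_def power_mult_distrib sum_nonneg)
      finally show ?thesis .
    qed
    then have "Re (quad_form n (\<lambda>i j. \<sigma> $$ (i, j)) v) \<le> (\<Sum>k<n. (\<Sum>i<n. (cmod (c k i))\<^sup>2) * V)"
      unfolding sig by (rule sum_mono)
    also have "\<dots> = V"
      by (simp add: norm flip: sum_distrib_right)
    finally have le: "Re (quad_form n (\<lambda>i j. \<sigma> $$ (i, j)) v) \<le> V" .
    have "quad_form n (\<lambda>i j. (1\<^sub>m n - \<sigma>) $$ (i, j)) v
        = quad_form n (\<lambda>i j. 1\<^sub>m n $$ (i, j) - \<sigma> $$ (i, j)) v"
      using carr by (intro quad_form_cong) auto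
    also have "\<dots> = of_real V - quad_form n (\<lambda>i j. \<sigma> $$ (i, j)) v"
      unfolding one[symmetric] quad_form_def by (simp only: right_diff_distrib left_diff_distrib sum_subtractf)
    finally show ?thesis
      using le by simp
  qed
  ultimately show ?thesis
    using carr unfolding psd_ops_iff psd_kernel_def by (simp add: minus_carrier_mat)
qed

lemma mtrace_mult:
  assumes "A \<in> carrier_mat n n" and "B \<in> carrier_mat n n"
  shows "mtrace (A * B) = (\<Sum>i<n. \<Sum>j<n. A $$ (i, j) * B $$ (j, i))"
  using assms by (simp add: mtrace_def scalar_prod_def lessThan_atLeast0)

text \<open>With rank-one decompositions of both factors, the trace is the sum of the squared moduli
  of the mutual inner products. In particular it is real, so taking \<open>Re\<close> of it loses
  nothing.\<close>

lemma mtrace_mult_psd_nonneg: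
  assumes "A \<in> psd_ops n" and "B \<in> psd_ops n"
  obtains t where "0 \<le> t" and "mtrace (A * B) = complex_of_real t"
proof -
  obtain c where c: "\<And>i j. i < n \<Longrightarrow> j < n \<Longrightarrow> A $$ (i, j) = (\<Sum>k<n. c k i * cnj (c k j))"
    using psd_opsE[OF assms(1)] by blast
  obtain e where e: "\<And>i j. i < n \<Longrightarrow> j < n \<Longrightarrow> B $$ (i, j) = (\<Sum>k<n. e k i * cnj (e k j))"
    using psd_opsE[OF assms(2)] by blast
  \<comment> \<open>The inner products of the two families of factor vectors. The swaps below move
    the family indices \<open>k\<close> and \<open>l\<close> outside, so that the inner double sum
    factors.\<close>
  define z where "z = (\<lambda>k l. \<Sum>j<n. cnj (c k j) * e l j)"
  have "mtrace (A * B) = (\<Sum>i<n. \<Sum>j<n. \<Sum>k<n. \<Sum>l<n. c k i * cnj (c k j) * (e l j * cnj (e l i)))"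
    unfolding mtrace_mult[OF assms[THEN psd_ops_carrier]]
    by (intro sum.cong refl) (simp add: c e sum_product)
  also have "\<dots> = (\<Sum>i<n. \<Sum>k<n. \<Sum>j<n. \<Sum>l<n. c k i * cnj (c k j) * (e l j * cnj (e l i)))"
    by (intro sum.cong refl sum.swap)
  also have "\<dots> = (\<Sum>k<n. \<Sum>i<n. \<Sum>l<n. \<Sum>j<n. c k i * cnj (c k j) * (e l j * cnj (e l i)))"
    by (subst sum.swap) (intro sum.cong refl sum.swap)
  also have "\<dots> = (\<Sum>k<n. \<Sum>l<n. \<Sum>i<n. \<Sum>j<n. c k i * cnj (c k j) * (e l j * cnj (e l i)))"
    by (intro sum.cong refl sum.swap)
  also have "\<dots> = (\<Sum>k<n. \<Sum>l<n. cnj (z k l) * z k l)"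
    unfolding z_def cnj_sum sum_product by (intro sum.cong refl) (simp add: mult_ac)
  also have "\<dots> = complex_of_real (\<Sum>k<n. \<Sum>l<n. (cmod (z k l))\<^sup>2)"
    unfolding of_real_sum complex_norm_square by (simp add: mult.commute)
  finally show ?thesis
    by (rule that[rotated]) (simp add: sum_nonneg)
qed

section \<open>Separable operators\<close>

lemma mat_sum_insert:
  assumes "finite I" and "i \<notin> I" and "F i \<in> carrier_mat n n"
  shows "mat_sum n F (insert i I) = mat_sum n F I + F i"
  using assms by (intro eq_matI) (auto simp: mat_sum_def)

lemma mat_sum_carrier: "mat_sum n F I \<in> carrier_mat n n"
  by (simp add: mat_sum_def)

lemma mat_sum_empty: "mat_sum n F {} = 0\<^sub>m n n"
  by (intro eq_matI) (auto simp: mat_sum_def)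

lemma mat_sum_psd:
  assumes "finite I" and "\<And>i. i \<in> I \<Longrightarrow> F i \<in> psd_ops n"
  shows "mat_sum n F I \<in> psd_ops n"
  using assms
  by (induction I) (simp_all add: mat_sum_empty psd_ops_zero mat_sum_insert psd_ops_carrier psd_ops_add)

section \<open>Kronecker products\<close>

lemma kronecker_carrier:
  "A \<in> carrier_mat a a \<Longrightarrow> B \<in> carrier_mat b b \<Longrightarrow> kronecker A B \<in> carrier_mat (a * b) (a * b)"
  by (auto simp: kronecker_def)

lemma kronecker_index:
  assumes "A \<in> carrier_mat a a" and "B \<in> carrier_mat b b" and "i < a * b" and "j < a * b"
  shows "kronecker A B $$ (i, j) = A $$ (i div b, j div b) * B $$ (i mod b, j mod b)"
    and "i div b < a" and "j div b < a" and "i mod b < b" and "j mod b < b"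
proof -
  have "0 < b"
    using assms(3) by (cases b) auto
  with assms show "kronecker A B $$ (i, j) = A $$ (i div b, j div b) * B $$ (i mod b, j mod b)"
    and "i div b < a" and "j div b < a" and "i mod b < b" and "j mod b < b"
    by (auto simp: kronecker_def less_mult_imp_div_less)
qed

lemma kronecker_zero_right:
  assumes "A \<in> carrier_mat a a"
  shows "kronecker A (0\<^sub>m b b) = 0\<^sub>m (a * b) (a * b)"
proof (rule eq_matI)
  fix i j assume "i < dim_row (0\<^sub>m (a * b) (a * b))" "j < dim_col (0\<^sub>m (a * b) (a * b))"
  then have ij: "i < a * b" "j < a * b" by auto
  show "kronecker A (0\<^sub>m b b) $$ (i, j) = 0\<^sub>m (a * b) (a * b) $$ (i, j)"
    using kronecker_index[OF assms zero_carrier_mat ij] ij by simp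
qed (use assms in \<open>auto simp: kronecker_def\<close>)

lemma kronecker_add_right:
  assumes "A \<in> carrier_mat a a" and "B \<in> carrier_mat b b" and "C \<in> carrier_mat b b"
  shows "kronecker A (B + C) = kronecker A B + kronecker A C"
proof -
  have "B + C \<in> carrier_mat b b" using assms by simp
  note carr = kronecker_carrier[OF assms(1) this] kronecker_carrier[OF assms(1,2)]
    kronecker_carrier[OF assms(1,3)]
  show ?thesis
  proof (rule eq_matI)
    fix i j assume "i < dim_row (kronecker A B + kronecker A C)" "j < dim_col (kronecker A B + kronecker A C)"
    then have ij: "i < a * b" "j < a * b" using carr by auto
    then show "kronecker A (B + C) $$ (i, j) = (kronecker A B + kronecker A C) $$ (i, j)"
      using assms carr kronecker_index[OF _ _ ij, of A B]
      by (simp add: kronecker_index[of _ a _ b] algebra_simps)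
  qed (use carr in auto)
qed

lemma kronecker_smult:
  assumes "A \<in> carrier_mat a a" and "B \<in> carrier_mat b b"
  shows "kronecker (s \<cdot>\<^sub>m A) (t \<cdot>\<^sub>m B) = (s * t) \<cdot>\<^sub>m kronecker A B"
proof -
  have "s \<cdot>\<^sub>m A \<in> carrier_mat a a" "t \<cdot>\<^sub>m B \<in> carrier_mat b b" using assms by simp_all
  note carr = kronecker_carrier[OF this] kronecker_carrier[OF assms]
  show ?thesis
  proof (rule eq_matI)
    fix i j assume "i < dim_row ((s * t) \<cdot>\<^sub>m kronecker A B)" "j < dim_col ((s * t) \<cdot>\<^sub>m kronecker A B)"
    then have ij: "i < a * b" "j < a * b" using carr by auto
    then show "kronecker (s \<cdot>\<^sub>m A) (t \<cdot>\<^sub>m B) $$ (i, j) = ((s * t) \<cdot>\<^sub>m kronecker A B) $$ (i, j)"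
      using assms carr kronecker_index[OF _ _ ij, of A B]
      by (simp add: kronecker_index[of _ a _ b])
  qed (use carr in auto)
qed

lemma kronecker_one: "kronecker (1\<^sub>m a) (1\<^sub>m b) = 1\<^sub>m (a * b)"
proof (rule eq_matI)
  fix i j assume "i < dim_row (1\<^sub>m (a * b))" "j < dim_col (1\<^sub>m (a * b))"
  then have ij: "i < a * b" "j < a * b" by auto
  have "i div b = j div b \<and> i mod b = j mod b \<longleftrightarrow> i = j"
    by (metis div_mult_mod_eq)
  then show "kronecker (1\<^sub>m a) (1\<^sub>m b) $$ (i, j) = (1\<^sub>m (a * b) $$ (i, j) :: complex)"
    using kronecker_index[OF _ _ ij, of "1\<^sub>m a" "1\<^sub>m b"] ij by auto
qed (auto simp: kronecker_def)

text \<open>The Kronecker products of the factor vectors of \<open>A\<close> and \<open>B\<close>,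
  indexed by pairs, are factor vectors of the product.\<close>

lemma kronecker_psd:
  assumes "A \<in> psd_ops a" and "B \<in> psd_ops b"
  shows "kronecker A B \<in> psd_ops (a * b)"
proof -
  note carr = assms[THEN psd_ops_carrier]
  obtain c where c: "\<And>i j. i < a \<Longrightarrow> j < a \<Longrightarrow> A $$ (i, j) = (\<Sum>k<a. c k i * cnj (c k j))"
    using psd_opsE[OF assms(1)] by blast
  obtain e where e: "\<And>i j. i < b \<Longrightarrow> j < b \<Longrightarrow> B $$ (i, j) = (\<Sum>k<b. e k i * cnj (e k j))"
    using psd_opsE[OF assms(2)] by blast
  show ?thesis
  proof (rule psd_opsI[where K = "{..<a} \<times> {..<b}"
        and c = "\<lambda>(k, l) i. c k (i div b) * e l (i mod b)"])
    fix i j assume ij: "i < a * b" "j < a * b"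
    show "kronecker A B $$ (i, j) = (\<Sum>kl\<in>{..<a} \<times> {..<b}.
        (case kl of (k, l) \<Rightarrow> \<lambda>i. c k (i div b) * e l (i mod b)) i *
        cnj ((case kl of (k, l) \<Rightarrow> \<lambda>i. c k (i div b) * e l (i mod b)) j))"
      using kronecker_index[OF carr ij]
      by (simp add: c e sum_product sum.cartesian_product split_def mult_ac)
  qed (rule kronecker_carrier[OF carr])
qed

section \<open>Product states and the cone they generate\<close>

lemma tensor_Cons: "tensor (A # As) = kronecker A (tensor As)"
  by (simp add: tensor_def)

lemma tensor_psd:
  "list_all2 (\<lambda>A d. A \<in> states d) As ds \<Longrightarrow> tensor As \<in> psd_ops (prod_list ds)"
proof (induction As ds rule: list_all2_induct)
  case Nil
  then show ?case using psd_ops_one[of 1] by (simp add: tensor_def)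
next
  case (Cons A As d ds)
  then show ?case by (simp add: tensor_Cons states_def kronecker_psd)
qed

text \<open>Lists of states matched with \<open>ds\<close> by \<open>list_all2\<close> replace the
  doubly indexed family, which makes structural induction on \<open>ds\<close> available.\<close>

lemma separable_ops_iff:
  "E \<in> separable_ops ds \<longleftrightarrow> (\<exists>(L :: nat) (p :: nat \<Rightarrow> real) S.
     (\<forall>l<L. 0 \<le> p l \<and> list_all2 (\<lambda>A d. A \<in> states d) (S l) ds) \<and>
     E = mat_sum (prod_list ds) (\<lambda>l. complex_of_real (p l) \<cdot>\<^sub>m tensor (S l)) {..<L})"
  (is "_ \<longleftrightarrow> ?R")
proof
  assume "E \<in> separable_ops ds"
  then obtain L :: nat and p :: "nat \<Rightarrow> real" and \<sigma> where *: "\<forall>l<L. 0 \<le> p l"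
    "\<forall>l<L. \<forall>k<length ds. \<sigma> l k \<in> states (ds ! k)"
    "E = mat_sum (prod_list ds)
       (\<lambda>l. complex_of_real (p l) \<cdot>\<^sub>m tensor (map (\<sigma> l) [0..<length ds])) {..<L}"
    unfolding separable_ops_def by blast
  show ?R
    by (rule exI[of _ L], rule exI[of _ p], rule exI[of _ "\<lambda>l. map (\<sigma> l) [0..<length ds]"])
      (use * in \<open>simp add: list_all2_conv_all_nth\<close>)
next
  assume ?R
  then obtain L :: nat and p :: "nat \<Rightarrow> real" and S where *: "\<And>l. l < L \<Longrightarrow> 0 \<le> p l"
    "\<And>l. l < L \<Longrightarrow> list_all2 (\<lambda>A d. A \<in> states d) (S l) ds"
    "E = mat_sum (prod_list ds) (\<lambda>l. complex_of_real (p l) \<cdot>\<^sub>m tensor (S l)) {..<L}"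
    by blast
  have "E \<in> psd_ops (prod_list ds)"
    unfolding *(3) by (rule mat_sum_psd) (auto intro: psd_ops_smult tensor_psd *)
  moreover have S: "map (\<lambda>k. S l ! k) [0..<length ds] = S l" if "l < L" for l
    using list_all2_lengthD[OF *(2)[OF that]] map_nth[of "S l"] by simp
  have eq: "E = mat_sum (prod_list ds)
      (\<lambda>l. complex_of_real (p l) \<cdot>\<^sub>m tensor (map (\<lambda>k. S l ! k) [0..<length ds])) {..<L}"
    unfolding *(3) mat_sum_def by (simp add: S)
  have states: "\<forall>l<L. \<forall>k<length ds. S l ! k \<in> states (ds ! k)"
    using *(2) by (simp add: list_all2_conv_all_nth)
  ultimately show "E \<in> separable_ops ds"
    unfolding separable_ops_def
    by (intro CollectI conjI exI[of _ L] exI[of _ p] exI[of _ "\<lambda>l k. S l ! k"])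
      (use *(1) eq states in simp_all)
qed

lemma separable_ops_psd: "E \<in> separable_ops ds \<Longrightarrow> E \<in> psd_ops (prod_list ds)"
  by (simp add: separable_ops_def)

lemma separable_ops_carrier:
  "E \<in> separable_ops ds \<Longrightarrow> E \<in> carrier_mat (prod_list ds) (prod_list ds)"
  by (rule psd_ops_carrier[OF separable_ops_psd])

lemma smult_tensor_carrier:
  "list_all2 (\<lambda>A d. A \<in> states d) S ds \<Longrightarrow>
     a \<cdot>\<^sub>m tensor S \<in> carrier_mat (prod_list ds) (prod_list ds)"
  by (simp add: psd_ops_carrier tensor_psd)

lemma zero_separable: "0\<^sub>m (prod_list ds) (prod_list ds) \<in> separable_ops ds"
  unfolding separable_ops_iff by (rule exI[of _ 0]) (simp add: mat_sum_empty)

text \<open>The new term is stored at the fresh index \<open>L\<close>.\<close>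

lemma separable_ops_add_product:
  assumes "E \<in> separable_ops ds" and p: "0 \<le> p" and S: "list_all2 (\<lambda>A d. A \<in> states d) S ds"
  shows "E + complex_of_real p \<cdot>\<^sub>m tensor S \<in> separable_ops ds"
proof -
  obtain L :: nat and q :: "nat \<Rightarrow> real" and T where *:
    "\<And>l. l < L \<Longrightarrow> 0 \<le> q l \<and> list_all2 (\<lambda>A d. A \<in> states d) (T l) ds"
    "E = mat_sum (prod_list ds) (\<lambda>l. complex_of_real (q l) \<cdot>\<^sub>m tensor (T l)) {..<L}"
    using assms(1) unfolding separable_ops_iff by blast
  let ?F = "\<lambda>l. complex_of_real ((q(L := p)) l) \<cdot>\<^sub>m tensor ((T(L := S)) l)"
  have "mat_sum (prod_list ds) ?F {..<L} = E"
    unfolding *(2) mat_sum_def by simp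
  then have eq: "mat_sum (prod_list ds) ?F {..<Suc L} = E + complex_of_real p \<cdot>\<^sub>m tensor S"
    using smult_tensor_carrier[OF S] by (simp add: lessThan_Suc mat_sum_insert)
  have states: "\<forall>l<Suc L. 0 \<le> (q(L := p)) l \<and> list_all2 (\<lambda>A d. A \<in> states d) ((T(L := S)) l) ds"
    using *(1) p S by (simp add: less_Suc_eq)
  show ?thesis
    unfolding separable_ops_iff
    by (rule exI[of _ "Suc L"], rule exI[of _ "q(L := p)"], rule exI[of _ "T(L := S)"],
        rule conjI[OF states eq[symmetric]])
qed

text \<open>Induction over the partial sums of a decomposition. From here on separable operators are
  handled as a cone generated by product states, without explicit index families.\<close>

lemma separable_ops_induct [consumes 1, case_names zero add]:
  assumes "E \<in> separable_ops ds"
    and zero: "P (0\<^sub>m (prod_list ds) (prod_list ds))"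
    and add: "\<And>E p S. E \<in> separable_ops ds \<Longrightarrow> P E \<Longrightarrow> 0 \<le> p \<Longrightarrow>
      list_all2 (\<lambda>A d. A \<in> states d) S ds \<Longrightarrow> P (E + complex_of_real p \<cdot>\<^sub>m tensor S)"
  shows "P E"
proof -
  obtain L :: nat and q :: "nat \<Rightarrow> real" and T where *:
    "\<And>l. l < L \<Longrightarrow> 0 \<le> q l \<and> list_all2 (\<lambda>A d. A \<in> states d) (T l) ds"
    "E = mat_sum (prod_list ds) (\<lambda>l. complex_of_real (q l) \<cdot>\<^sub>m tensor (T l)) {..<L}"
    using assms(1) unfolding separable_ops_iff by blast
  let ?F = "\<lambda>l. complex_of_real (q l) \<cdot>\<^sub>m tensor (T l)"
  have "mat_sum (prod_list ds) ?F {..<M} \<in> separable_ops ds \<and> P (mat_sum (prod_list ds) ?F {..<M})"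
    if "M \<le> L" for M
    using that
  proof (induction M)
    case 0
    then show ?case by (simp add: mat_sum_empty zero zero_separable)
  next
    case (Suc M)
    then have "0 \<le> q M" "list_all2 (\<lambda>A d. A \<in> states d) (T M) ds"
      using *(1) by auto
    with Suc show ?case
      by (simp add: lessThan_Suc mat_sum_insert smult_tensor_carrier add separable_ops_add_product)
  qed
  then show ?thesis
    using *(2) by blast
qed

lemma separable_ops_add:
  assumes "E \<in> separable_ops ds" and "F \<in> separable_ops ds"
  shows "E + F \<in> separable_ops ds"
  using assms(2)
proof (induction rule: separable_ops_induct)
  case zero
  then show ?case using assms(1) separable_ops_carrier[OF assms(1)] by simp
next
  case (add F p S)
  have "E + (F + complex_of_real p \<cdot>\<^sub>m tensor S) = (E + F) + complex_of_real p \<cdot>\<^sub>m tensor S"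
    using assoc_add_mat[OF separable_ops_carrier[OF assms(1)] separable_ops_carrier[OF add.hyps(1)]
        smult_tensor_carrier[OF add.hyps(3)]] by simp
  then show ?case
    using separable_ops_add_product[OF add.IH add.hyps(2,3)] by simp
qed

lemma tensor_separable:
  assumes "list_all2 (\<lambda>A d. A \<in> states d) S ds"
  shows "tensor S \<in> separable_ops ds"
proof -
  have "0\<^sub>m (prod_list ds) (prod_list ds) + complex_of_real 1 \<cdot>\<^sub>m tensor S = tensor S"
    using smult_tensor_carrier[OF assms, of 1] by (intro eq_matI) auto
  then show ?thesis
    using separable_ops_add_product[OF zero_separable _ assms, of 1] by simp
qed

text \<open>Each product term absorbs the trace of \<open>A\<close> into its weight and the
  normalized \<open>A\<close> as its first factor. This admits factors such as \<open>1 - A\<close>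
  in the telescoping below, which need not be states.\<close>

lemma kronecker_separable:
  assumes "A \<in> psd_ops d" and "0 < d" and "E \<in> separable_ops ds"
  shows "kronecker A E \<in> separable_ops (d # ds)"
  using assms(3)
proof (induction rule: separable_ops_induct)
  case zero
  show ?case
    using zero_separable[of "d # ds"] by (simp add: kronecker_zero_right[OF psd_ops_carrier[OF assms(1)]])
next
  case (add E p S)
  obtain t \<sigma> where t: "0 \<le> t" "\<sigma> \<in> states d" "A = complex_of_real t \<cdot>\<^sub>m \<sigma>"
    using psd_ops_eq_smult_state[OF assms(1,2)] .
  have "\<sigma> \<in> carrier_mat d d"
    using t(2) by (simp add: states_def psd_ops_carrier)
  then have "kronecker A (complex_of_real p \<cdot>\<^sub>m tensor S) = complex_of_real (t * p) \<cdot>\<^sub>m tensor (\<sigma> # S)"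
    unfolding t(3) by (simp add: kronecker_smult[OF _ psd_ops_carrier[OF tensor_psd[OF add.hyps(3)]]] tensor_Cons)
  then have "kronecker A (E + complex_of_real p \<cdot>\<^sub>m tensor S)
      = kronecker A E + complex_of_real (t * p) \<cdot>\<^sub>m tensor (\<sigma> # S)"
    using kronecker_add_right[OF psd_ops_carrier[OF assms(1)] separable_ops_carrier[OF add.hyps(1)]
        smult_tensor_carrier[OF add.hyps(3)]] by simp
  then show ?case
    using separable_ops_add_product[OF add.IH, of "t * p" "\<sigma> # S"] t add.hyps(2,3) by simp
qed

section \<open>The identity and the complements of product states\<close>

lemma one_separable:
  "\<forall>d\<in>set ds. 0 < d \<Longrightarrow> 1\<^sub>m (prod_list ds) \<in> separable_ops ds"
proof (induction ds)
  case Nil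
  then show ?case using tensor_separable[of "[]" "[]"] by (simp add: tensor_def)
next
  case (Cons d ds)
  then show ?case
    using kronecker_separable[OF psd_ops_one[of d], of "1\<^sub>m (prod_list ds)" ds]
    by (simp add: kronecker_one)
qed

lemma one_minus_one_mat: "1\<^sub>m n - 1\<^sub>m n = (0\<^sub>m n n :: complex mat)"
  by (intro eq_matI) auto

text \<open>
  Telescoping: \<open>1 \<otimes> 1 - A \<otimes> T = (1 - A) \<otimes> 1 + A \<otimes> (1 - T)\<close>.
\<close>

lemma one_minus_tensor_separable:
  assumes "list_all2 (\<lambda>A d. A \<in> states d) S ds" and "\<forall>d\<in>set ds. 0 < d"
  shows "1\<^sub>m (prod_list ds) - tensor S \<in> separable_ops ds"
  using assms
proof (induction S ds rule: list_all2_induct)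
  case Nil
  show ?case using zero_separable[of "[]"] by (simp add: tensor_def one_minus_one_mat)
next
  case (Cons A S d ds)
  let ?N = "prod_list ds" and ?T = "tensor S"
  have A: "A \<in> psd_ops d"
    using Cons by (simp add: states_def)
  have T: "?T \<in> carrier_mat ?N ?N"
    using Cons by (simp add: psd_ops_carrier tensor_psd)
  note A' = psd_ops_carrier[OF A]
  have A1: "1\<^sub>m d - A \<in> carrier_mat d d" and T1: "1\<^sub>m ?N - ?T \<in> carrier_mat ?N ?N"
    using A' T by (simp_all add: minus_carrier_mat)
  have "1\<^sub>m (d * ?N) - kronecker A ?T = kronecker (1\<^sub>m d - A) (1\<^sub>m ?N) + kronecker A (1\<^sub>m ?N - ?T)"
  proof (rule eq_matI)
    note carr = kronecker_carrier[OF A' T1] kronecker_carrier[OF A1 one_carrier_mat[of ?N]]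
      kronecker_carrier[OF A' T]
    {
      fix i j
      assume "i < dim_row (kronecker (1\<^sub>m d - A) (1\<^sub>m ?N) + kronecker A (1\<^sub>m ?N - ?T))"
        "j < dim_col (kronecker (1\<^sub>m d - A) (1\<^sub>m ?N) + kronecker A (1\<^sub>m ?N - ?T))"
      then have ij: "i < d * ?N" "j < d * ?N" using carr by auto
      note ix = kronecker_index[OF _ _ ij]
      \<comment> \<open>Writing the identity as a Kronecker product lets every term factor over the
        same block indices, which reduces the claim to scalar algebra.\<close>
      have "(1\<^sub>m (d * ?N) - kronecker A ?T) $$ (i, j)
          = kronecker (1\<^sub>m d) (1\<^sub>m ?N) $$ (i, j) - kronecker A ?T $$ (i, j)"
        using ij carr by (simp add: kronecker_one)
      also have "\<dots> = kronecker (1\<^sub>m d - A) (1\<^sub>m ?N) $$ (i, j) + kronecker A (1\<^sub>m ?N - ?T) $$ (i, j)"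
        unfolding ix(1)[OF one_carrier_mat one_carrier_mat] ix(1)[OF A' T]
          ix(1)[OF A1 one_carrier_mat] ix(1)[OF A' T1]
        using ix(2-)[OF A' T] A' T by (simp add: algebra_simps)
      finally show "(1\<^sub>m (d * ?N) - kronecker A ?T) $$ (i, j)
          = (kronecker (1\<^sub>m d - A) (1\<^sub>m ?N) + kronecker A (1\<^sub>m ?N - ?T)) $$ (i, j)"
        using ij carr by simp
    }
  qed (use kronecker_carrier[OF A' T1] kronecker_carrier[OF A' T] in auto)
  moreover have "kronecker (1\<^sub>m d - A) (1\<^sub>m ?N) \<in> separable_ops (d # ds)"
    using Cons by (intro kronecker_separable one_minus_state_psd one_separable) auto
  moreover have "kronecker A (1\<^sub>m ?N - ?T) \<in> separable_ops (d # ds)"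
    using Cons A by (intro kronecker_separable) auto
  ultimately show ?case
    using separable_ops_add by (simp add: tensor_Cons)
qed

section \<open>Confidence and block positivity\<close>

text \<open>A test \<open>T\<close> for outcome \<open>j\<close>, with the complement assigned to
  the inconclusive outcome \<open>0\<close>.\<close>

lemma separable_measurement_binary:
  assumes T: "T \<in> separable_ops ds" and "1\<^sub>m (prod_list ds) - T \<in> separable_ops ds"
    and j: "j \<in> {1..n}"
  shows "separable_measurement ds n (\<lambda>i. if i = j then T
    else if i = 0 then 1\<^sub>m (prod_list ds) - T else 0\<^sub>m (prod_list ds) (prod_list ds))"
    (is "separable_measurement ds n ?M")
  unfolding separable_measurement_def
proof
  show "\<forall>i\<in>{0..n}. ?M i \<in> separable_ops ds"
    using assms zero_separable[of ds] by simp
  let ?N = "prod_list ds"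
  show "mat_sum ?N ?M {0..n} = 1\<^sub>m ?N"
  proof (rule eq_matI)
    fix a b assume "a < dim_row (1\<^sub>m ?N)" "b < dim_col (1\<^sub>m ?N)"
    then have ab: "a < ?N" "b < ?N" by auto
    have "mat_sum ?N ?M {0..n} $$ (a, b) = (\<Sum>i\<in>{0..n}. ?M i $$ (a, b))"
      using ab by (simp add: mat_sum_def)
    \<comment> \<open>Since \<open>j\<close> is not \<open>0\<close>, the two indicator terms never
      overlap.\<close>
    also have "\<dots> = (\<Sum>i\<in>{0..n}. (if i = j then T $$ (a, b) else 0)
        + (if i = 0 then (1\<^sub>m ?N - T) $$ (a, b) else 0))"
      using j ab by (intro sum.cong refl) auto
    also have "\<dots> = T $$ (a, b) + (1\<^sub>m ?N - T) $$ (a, b)"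
      using j by (simp add: sum.distrib)
    also have "\<dots> = 1\<^sub>m ?N $$ (a, b)"
      using ab separable_ops_carrier[OF T] by simp
    finally show "mat_sum ?N ?M {0..n} $$ (a, b) = 1\<^sub>m ?N $$ (a, b)" .
  qed (simp_all add: mat_sum_def)
qed

section \<open>Linearity of the trace pairing\<close>

lemma mtrace_mat_sum_mult:
  assumes "\<And>i. i \<in> I \<Longrightarrow> F i \<in> carrier_mat n n" and "B \<in> carrier_mat n n"
  shows "mtrace (mat_sum n F I * B) = (\<Sum>i\<in>I. mtrace (F i * B))"
proof -
  have "mtrace (mat_sum n F I * B) = (\<Sum>a<n. \<Sum>b<n. \<Sum>i\<in>I. F i $$ (a, b) * B $$ (b, a))"
    unfolding mtrace_mult[OF mat_sum_carrier assms(2)]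
    by (intro sum.cong refl) (simp add: mat_sum_def sum_distrib_right)
  also have "\<dots> = (\<Sum>a<n. \<Sum>i\<in>I. \<Sum>b<n. F i $$ (a, b) * B $$ (b, a))"
    by (intro sum.cong refl sum.swap)
  also have "\<dots> = (\<Sum>i\<in>I. \<Sum>a<n. \<Sum>b<n. F i $$ (a, b) * B $$ (b, a))"
    by (rule sum.swap)
  finally show ?thesis
    using assms by (simp add: mtrace_mult[of _ n])
qed

lemma mtrace_smult_mult:
  assumes "A \<in> carrier_mat n n" and "B \<in> carrier_mat n n"
  shows "mtrace ((a \<cdot>\<^sub>m A) * B) = a * mtrace (A * B)"
  using assms by (simp add: mtrace_mult[of _ n] sum_distrib_left mult.assoc)

lemma mtrace_minus_mult:
  assumes "A \<in> carrier_mat n n" and "A' \<in> carrier_mat n n" and "B \<in> carrier_mat n n"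
  shows "mtrace ((A - A') * B) = mtrace (A * B) - mtrace (A' * B)"
  using assms
  by (simp add: mtrace_mult[of _ n] minus_carrier_mat left_diff_distrib sum_subtractf)

lemma mtrace_mult_add_smult:
  assumes "X \<in> carrier_mat n n" and "A \<in> carrier_mat n n" and "B \<in> carrier_mat n n"
  shows "mtrace (X * (A + p \<cdot>\<^sub>m B)) = mtrace (X * A) + p * mtrace (X * B)"
proof -
  have "A + p \<cdot>\<^sub>m B \<in> carrier_mat n n" using assms by simp
  from mtrace_mult[OF assms(1) this]
  have "mtrace (X * (A + p \<cdot>\<^sub>m B))
      = (\<Sum>i<n. \<Sum>j<n. X $$ (i, j) * A $$ (j, i) + p * (X $$ (i, j) * B $$ (j, i)))"
    using assms by (simp add: algebra_simps)
  then show ?thesis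
    using assms by (simp add: mtrace_mult[of _ n] sum.distrib sum_distrib_left)
qed

text \<open>The pairing with \<open>X\<close> is linear and product states generate the separable
  cone, so nonnegativity extends from the generators to the whole cone.\<close>

lemma block_positiveI:
  assumes X: "X \<in> hermitian_ops (prod_list ds)"
    and prod: "\<And>S. list_all2 (\<lambda>A d. A \<in> states d) S ds \<Longrightarrow> 0 \<le> Re (mtrace (X * tensor S))"
  shows "X \<in> block_positive_ops ds"
proof -
  have carr: "X \<in> carrier_mat (prod_list ds) (prod_list ds)"
    using X by (simp add: hermitian_ops_def)
  have "0 \<le> Re (mtrace (X * F))" if "F \<in> separable_ops ds" for F
    using that
  proof (induction rule: separable_ops_induct)
    case zero
    show ?case using carr by (simp add: mtrace_def)
  next
    case (add F p S)
    then show ?case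
      using prod[OF add.hyps(3)]
      by (simp add: mtrace_mult_add_smult[OF carr separable_ops_carrier psd_ops_carrier[OF tensor_psd]])
  qed
  then show ?thesis
    using X by (simp add: block_positive_ops_def)
qed

lemma hermitian_ops_smult_minus:
  assumes "A \<in> hermitian_ops n" and "B \<in> hermitian_ops n"
  shows "complex_of_real s \<cdot>\<^sub>m A - complex_of_real t \<cdot>\<^sub>m B \<in> hermitian_ops n"
proof -
  have carr: "A \<in> carrier_mat n n" "B \<in> carrier_mat n n"
    using assms by (simp_all add: hermitian_ops_def)
  have "(complex_of_real s \<cdot>\<^sub>m A - complex_of_real t \<cdot>\<^sub>m B) $$ (i, j)
      = cnj ((complex_of_real s \<cdot>\<^sub>m A - complex_of_real t \<cdot>\<^sub>m B) $$ (j, i))" if "i < n" "j < n" for i j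
  proof -
    have "cnj (A $$ (j, i)) = A $$ (i, j)" "cnj (B $$ (j, i)) = B $$ (i, j)"
      using assms that unfolding hermitian_ops_iff by metis+
    then show ?thesis
      using carr that by simp
  qed
  then show ?thesis
    using carr by (simp add: hermitian_ops_iff minus_carrier_mat)
qed

theorem theorem2:
  fixes ds :: "nat list" and n :: nat
    and \<eta> :: "nat \<Rightarrow> real" and \<rho> :: "nat \<Rightarrow> complex mat" and j :: nat
  assumes "length ds \<ge> 2"
    and "\<forall>d\<in>set ds. d > 0"
    and "ensemble ds n \<eta> \<rho>"
    and "j \<in> {1..n}"
  shows "sep_max_confidence ds n \<eta> \<rho> j = block_positive_bound ds n \<eta> \<rho> j"
proof -
  define N where "N = prod_list ds"
  define \<rho>0 where "\<rho>0 = average_state ds n \<eta> \<rho>"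
  define tr where "tr = (\<lambda>A F. Re (mtrace (A * F)))"
  define C where "C = {confidence ds n \<eta> \<rho> j M | M.
     separable_measurement ds n M \<and> mtrace (\<rho>0 * M j) \<noteq> 0}"
  define X where "X = (\<lambda>q. complex_of_real q \<cdot>\<^sub>m \<rho>0 - complex_of_real (\<eta> j) \<cdot>\<^sub>m \<rho> j)"
  have \<rho>: "\<rho> i \<in> psd_ops N" "mtrace (\<rho> i) = 1" "0 < \<eta> i" if "i \<in> {1..n}" for i
    using assms(3) that by (auto simp: ensemble_def N_def states_def)
  have sum\<eta>: "(\<Sum>i=1..n. \<eta> i) = 1"
    using assms(3) by (simp add: ensemble_def)
  have \<rho>0: "\<rho>0 \<in> psd_ops N"
    unfolding \<rho>0_def average_state_def N_def[symmetric]
    by (rule mat_sum_psd) (auto intro!: psd_ops_smult \<rho> less_imp_le)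
  note carr = \<rho>(1)[THEN psd_ops_carrier] psd_ops_carrier[OF \<rho>0]
  have real: "0 \<le> tr A F \<and> mtrace (A * F) = of_real (tr A F)" if "A \<in> psd_ops N" "F \<in> psd_ops N" for A F
    using mtrace_mult_psd_nonneg[OF that] by (metis Re_complex_of_real tr_def)
  have tr\<rho>0: "tr \<rho>0 F = (\<Sum>i=1..n. \<eta> i * tr (\<rho> i) F)" if F: "F \<in> carrier_mat N N" for F
    unfolding tr_def \<rho>0_def average_state_def N_def[symmetric]
    by (subst mtrace_mat_sum_mult[OF _ F])
      (auto simp: mtrace_smult_mult[OF _ F] carr(1) intro!: sum.cong)
  \<comment> \<open>The inequality between \<open>\<eta> j\<close> times \<open>\<rho> j\<close> and
    the average state, in weak form: one term of a sum of nonnegative terms. It bounds confidences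
    by \<open>1\<close> and settles the case of a vanishing denominator.\<close>
  have le: "\<eta> j * tr (\<rho> j) F \<le> tr \<rho>0 F" if F: "F \<in> psd_ops N" for F
    unfolding tr\<rho>0[OF psd_ops_carrier[OF F]]
  proof (rule member_le_sum)
    fix i assume "i \<in> {1..n} - {j}"
    then show "0 \<le> \<eta> i * tr (\<rho> i) F"
      using \<rho>[of i] real[OF _ F, of "\<rho> i"] by simp
  qed (use assms(4) in auto)
  have trX: "tr (X q) F = q * tr \<rho>0 F - \<eta> j * tr (\<rho> j) F" if "F \<in> carrier_mat N N" for q F
    using that carr assms(4) by (simp add: tr_def X_def mtrace_minus_mult[of _ N] mtrace_smult_mult[of _ N])
  have conf: "confidence ds n \<eta> \<rho> j M = \<eta> j * tr (\<rho> j) (M j) / tr \<rho>0 (M j)" for M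
    by (simp add: confidence_def tr_def \<rho>0_def)
  have pos: "0 < tr \<rho>0 F" if "F \<in> psd_ops N" "mtrace (\<rho>0 * F) \<noteq> 0" for F
    using real[OF \<rho>0 that(1)] that(2) by (metis less_eq_real_def of_real_0)
  have Mj: "M j \<in> separable_ops ds" "M j \<in> psd_ops N" if "separable_measurement ds n M" for M
    using that assms(4) by (auto simp: separable_measurement_def N_def separable_ops_psd)
  have upper: "X q \<in> block_positive_ops ds \<longleftrightarrow> (\<forall>c\<in>C. c \<le> q)" for q
  proof
    assume X: "X q \<in> block_positive_ops ds"
    show "\<forall>c\<in>C. c \<le> q"
    proof
      fix c assume "c \<in> C"
      then obtain M where M: "separable_measurement ds n M" "mtrace (\<rho>0 * M j) \<noteq> 0"
        and c: "c = \<eta> j * tr (\<rho> j) (M j) / tr \<rho>0 (M j)"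
        by (auto simp: C_def conf)
      have "0 \<le> tr (X q) (M j)"
        using X Mj[OF M(1)] by (simp add: block_positive_ops_def tr_def)
      then show "c \<le> q"
        using pos[OF Mj(2)[OF M(1)] M(2)] trX[OF psd_ops_carrier[OF Mj(2)[OF M(1)]], of q]
        by (simp add: c field_simps)
    qed
  next
    assume q: "\<forall>c\<in>C. c \<le> q"
    show "X q \<in> block_positive_ops ds"
    proof (rule block_positiveI)
      show "X q \<in> hermitian_ops (prod_list ds)"
        unfolding X_def using \<rho>0 \<rho>(1)[OF assms(4)]
        by (intro hermitian_ops_smult_minus) (simp_all add: psd_ops_def N_def)
      fix S assume S: "list_all2 (\<lambda>A d. A \<in> states d) S ds"
      define T where "T = tensor S"
      have T: "T \<in> separable_ops ds" "T \<in> psd_ops N"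
        using S by (simp_all add: T_def N_def tensor_separable tensor_psd)
      \<comment> \<open>The measurement whose confidence for outcome \<open>j\<close> is the
        quotient of the two terms of \<open>tr (X q) T\<close>.\<close>
      define M where "M = (\<lambda>i. if i = j then T else if i = 0 then 1\<^sub>m N - T else 0\<^sub>m N N)"
      have M: "separable_measurement ds n M"
        unfolding M_def N_def using T(1) one_minus_tensor_separable[OF S assms(2)] assms(4)
        by (intro separable_measurement_binary) (simp_all add: T_def)
      have MT: "M j = T"
        by (simp add: M_def)
      have "0 \<le> tr (X q) T"
      proof (cases "mtrace (\<rho>0 * T) = 0")
        case True
        \<comment> \<open>The term with \<open>q\<close> vanishes, and by \<open>le\<close> the
          subtracted term is at most \<open>0\<close>; here \<open>q\<close> is not constrained by
          any confidence.\<close>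
        then show ?thesis
          using le[OF T(2)] trX[OF psd_ops_carrier[OF T(2)], of q] by (simp add: tr_def)
      next
        case False
        have "confidence ds n \<eta> \<rho> j M \<in> C"
          using M False by (auto simp: C_def MT)
        then have "\<eta> j * tr (\<rho> j) T / tr \<rho>0 T \<le> q"
          using q by (auto simp: conf MT)
        then show ?thesis
          using pos[OF T(2) False] trX[OF psd_ops_carrier[OF T(2)], of q] by (simp add: field_simps)
      qed
      then show "0 \<le> Re (mtrace (X q * tensor S))"
        by (simp add: tr_def T_def)
    qed
  qed
  have bdd: "c \<le> 1" if "c \<in> C" for c
  proof -
    obtain M where M: "separable_measurement ds n M" "mtrace (\<rho>0 * M j) \<noteq> 0"
      and c: "c = \<eta> j * tr (\<rho> j) (M j) / tr \<rho>0 (M j)"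
      using \<open>c \<in> C\<close> by (auto simp: C_def conf)
    then show ?thesis
      using le[OF Mj(2)[OF M(1)]] pos[OF Mj(2)[OF M(1)] M(2)] by simp
  qed
  \<comment> \<open>With the identity as outcome \<open>j\<close>, the denominator is the trace of
    the average state, which is \<open>1\<close>.\<close>
  have ne: "C \<noteq> {}"
  proof -
    have "1\<^sub>m N - 1\<^sub>m N \<in> separable_ops ds"
      using zero_separable[of ds] by (simp add: N_def one_minus_one_mat)
    then obtain M where M: "separable_measurement ds n M" "M j = 1\<^sub>m N"
      using separable_measurement_binary[OF one_separable[OF assms(2)] _ assms(4)]
      unfolding N_def by fastforce
    have "tr \<rho>0 (1\<^sub>m N) = (\<Sum>i=1..n. \<eta> i)"
      unfolding tr\<rho>0[OF one_carrier_mat] by (intro sum.cong refl) (simp add: tr_def right_mult_one_mat[OF carr(1)] \<rho>(2))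
    then have "mtrace (\<rho>0 * M j) \<noteq> 0"
      using sum\<eta> by (auto simp: tr_def M(2))
    then show ?thesis
      using M(1) by (auto simp: C_def)
  qed
  have bdd_above: "bdd_above C"
    unfolding bdd_above_def using bdd by blast
  \<comment> \<open>\<open>C\<close> is nonempty and bounded above, so \<open>Sup C\<close> is its
    least upper bound; by \<open>upper\<close> this is the least admissible \<open>q\<close>, and
    the minimum is attained.\<close>
  have "(LEAST q. X q \<in> block_positive_ops ds) = Sup C"
    unfolding upper
    by (rule Least_equality) (use cSup_upper[OF _ bdd_above] cSup_least[OF ne] in blast)+
  then show ?thesis
    unfolding sep_max_confidence_def block_positive_bound_def C_def X_def \<rho>0_def by simp
qed

end
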